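(* For any non-empty finite simple graph $G$, the following are equivalent: (i) $J(G)=G$; (ii) $J^k(G)=G$ for some integer $k\ge 1$; (iii) $G$ is $C_5$ or the net graph $N$.
   Context: The jump graph $J(G)$ of a graph $G$ has vertex set $E(G)$, and two vertices of $J(G)$ are adjacent iff the corresponding edges of $G$ share no endpoint. Set $J^0(G)=G$ and $J^k(G)=J(J^{k-1}(G))$. $C_5$ is the 5-cycle; the net graph $N$ is a triangle with one pendant edge attached at each of its three vertices. Equality of graphs means isomorphism, where graphs differing only by isolated vertices are regarded as equal. *)

theory Defs
  imports Main "HOL-Library.FSet"
begin

record 'a ugraph =
  vertices :: "'a set"
  edges :: "'a set set"

definition finite_simple_graph :: "'a ugraph \<Rightarrow> bool" where
  "finite_simple_graph G \<longleftrightarrow>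
     finite (vertices G) \<and> (\<forall>e \<in> edges G. e \<subseteq> vertices G \<and> card e = 2)"

definition graph_iso :: "'a ugraph \<Rightarrow> 'b ugraph \<Rightarrow> bool" where
  "graph_iso G H \<longleftrightarrow>
     (\<exists>f. bij_betw f (vertices G) (vertices H) \<and>
          (\<forall>u \<in> vertices G. \<forall>v \<in> vertices G. {u, v} \<in> edges G \<longleftrightarrow> {f u, f v} \<in> edges H))"

definition del_isolated :: "'a ugraph \<Rightarrow> 'a ugraph" where
  "del_isolated G = \<lparr>vertices = {v \<in> vertices G. \<exists>e \<in> edges G. v \<in> e}, edges = edges G\<rparr>"

text \<open>Equality of graphs: isomorphism, disregarding isolated vertices.\<close>

definition graph_eq :: "'a ugraph \<Rightarrow> 'b ugraph \<Rightarrow> bool" (infix "\<simeq>\<^sub>g" 50) where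
  "G \<simeq>\<^sub>g H \<longleftrightarrow> graph_iso (del_isolated G) (del_isolated H)"

text \<open>In a simple graph two edges without a common endpoint are automatically distinct.\<close>

definition jump_graph :: "'a ugraph \<Rightarrow> 'a set ugraph" where
  "jump_graph G =
     \<lparr>vertices = edges G,
      edges = {{e, f} | e f. e \<in> edges G \<and> f \<in> edges G \<and> e \<inter> f = {}}\<rparr>"

text \<open>
  The vertices of the jump graph live in a different type from those of the graph itself.
  To iterate, vertices are represented in a single type: an original vertex, or an edge
  given as the finite set of its endpoints.
\<close>

datatype 'a jvertex = Orig 'a | Edge "'a jvertex fset"

definition relabel :: "('a \<Rightarrow> 'b) \<Rightarrow> 'a ugraph \<Rightarrow> 'b ugraph" where
  "relabel f G = \<lparr>vertices = f ` vertices G, edges = (\<lambda>e. f ` e) ` edges G\<rparr>"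

primrec jump_iter :: "nat \<Rightarrow> 'a ugraph \<Rightarrow> 'a jvertex ugraph" where
  "jump_iter 0 G = relabel Orig G"
| "jump_iter (Suc k) G = relabel (\<lambda>e. Edge (Abs_fset e)) (jump_graph (jump_iter k G))"

definition C5 :: "nat ugraph" where
  "C5 = \<lparr>vertices = {0, 1, 2, 3, 4},
         edges = {{0, 1}, {1, 2}, {2, 3}, {3, 4}, {4, 0}}\<rparr>"

definition net_graph :: "nat ugraph" where
  "net_graph = \<lparr>vertices = {0, 1, 2, 3, 4, 5},
                edges = {{0, 1}, {1, 2}, {2, 0}, {0, 3}, {1, 4}, {2, 5}}\<rparr>"

text \<open>The relabellings used in the iteration are isomorphisms.\<close>

lemma finite_simple_graph_jump:
  assumes "finite_simple_graph G"
  shows "finite_simple_graph (jump_graph G)"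
proof -
  have "edges G \<subseteq> Pow (vertices G)" "finite (vertices G)"
    using assms by (auto simp: finite_simple_graph_def)
  then have "finite (edges G)" by (meson finite_Pow_iff finite_subset)
  moreover have "e \<noteq> f" if "e \<in> edges G" "e \<inter> f = {}" for e f
    using that assms by (auto simp: finite_simple_graph_def)
  then have "card {e, f} = 2" if "e \<in> edges G" "e \<inter> f = {}" for e f
    using that by (simp add: card_insert_if)
  ultimately show ?thesis
    unfolding finite_simple_graph_def jump_graph_def by auto
qed

lemma finite_simple_graph_relabel:
  assumes "finite_simple_graph G" "inj_on f (vertices G)"
  shows "finite_simple_graph (relabel f G)"
proof -
  have "f ` e \<subseteq> f ` vertices G \<and> card (f ` e) = 2" if "e \<in> edges G" for e
  proof -
    from that assms(1) have "e \<subseteq> vertices G" "card e = 2"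
      by (simp_all add: finite_simple_graph_def)
    then show ?thesis
      using card_image[OF inj_on_subset[OF assms(2)]] by (simp add: image_mono)
  qed
  then show ?thesis
    using assms(1) by (simp add: finite_simple_graph_def relabel_def)
qed

lemma graph_iso_relabel:
  assumes "finite_simple_graph G" "inj_on f (vertices G)"
  shows "graph_iso G (relabel f G)"
  unfolding graph_iso_def
proof (intro exI conjI ballI)
  show "bij_betw f (vertices G) (vertices (relabel f G))"
    using assms(2) by (simp add: relabel_def bij_betw_def)
  fix u v assume uv: "u \<in> vertices G" "v \<in> vertices G"
  show "{u, v} \<in> edges G \<longleftrightarrow> {f u, f v} \<in> edges (relabel f G)"
  proof
    assume "{f u, f v} \<in> edges (relabel f G)"
    then have "f ` {u, v} \<in> (\<lambda>e. f ` e) ` edges G" by (simp add: relabel_def)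
    then obtain e where e: "e \<in> edges G" "f ` {u, v} = f ` e" by (rule imageE)
    then have "e \<subseteq> vertices G" using assms(1) by (auto simp: finite_simple_graph_def)
    then have "{u, v} = e"
      using inj_on_image_eq_iff[OF assms(2), of "{u, v}" e] e(2) uv by simp
    then show "{u, v} \<in> edges G" using e by simp
  next
    assume "{u, v} \<in> edges G"
    then have "f ` {u, v} \<in> (\<lambda>e. f ` e) ` edges G" by (rule imageI)
    then show "{f u, f v} \<in> edges (relabel f G)" by (simp add: relabel_def)
  qed
qed

lemma inj_on_Edge_Abs_fset:
  assumes "finite_simple_graph G"
  shows "inj_on (\<lambda>e. Edge (Abs_fset e)) (vertices (jump_graph G))"
proof (rule inj_onI)
  fix e f assume "e \<in> vertices (jump_graph G)" "f \<in> vertices (jump_graph G)"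
    and eq: "Edge (Abs_fset e) = Edge (Abs_fset f)"
  then have "finite e" "finite f"
    using assms by (simp_all add: finite_simple_graph_def jump_graph_def card_ge_0_finite)
  then show "e = f" using eq by (simp add: Abs_fset_inject)
qed

lemma inj_on_Orig: "inj_on Orig A"
  by (simp add: inj_on_def)

lemma finite_simple_graph_jump_iter:
  "finite_simple_graph G \<Longrightarrow> finite_simple_graph (jump_iter k G)"
  by (induction k)
     (simp_all add: finite_simple_graph_relabel inj_on_Orig finite_simple_graph_jump
       inj_on_Edge_Abs_fset)

lemma graph_iso_jump_iter_0:
  "finite_simple_graph G \<Longrightarrow> graph_iso G (jump_iter 0 G)"
  by (simp add: graph_iso_relabel inj_on_Orig)

lemma graph_iso_jump_iter_Suc:
  "finite_simple_graph G \<Longrightarrow> graph_iso (jump_graph (jump_iter k G)) (jump_iter (Suc k) G)"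
  by (simp add: graph_iso_relabel finite_simple_graph_jump inj_on_Edge_Abs_fset
      finite_simple_graph_jump_iter)

end

theory Submission
  imports Defs
begin

text \<open>
  Both \<open>C\<^sub>5\<close> and the net \<open>N\<close> are fixed by \<open>J\<close>, have at least five edges and degrees at most 3,
  and the degrees of two non-adjacent vertices add up to at most 4. In a graph that contains such a
  core, every other edge is therefore disjoint from some edge of the core, and even from two if it
  leaves the vertex set of the core. So \<open>J\<close> does not decrease the number of edges, and increases it
  within two steps unless the graph is the core itself. Since containment is preserved by \<open>J\<close>, a
  graph \<open>G\<close> with periodic iterates is a core as soon as one of the iterates contains one.

  Suppose that none does. As \<open>J(J(G))\<close> has an edge, \<open>G\<close> contains four edges that already produce
  one. Starting from the graphs formed by four such edges, add edges one at a time and discard all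
  graphs with an iterate that contains a core. Up to isomorphism, 6, 10 and 6 graphs with four, five
  and six edges remain, and none with seven. As their sixth iterates are empty, \<open>G\<close> equals none of
  them, so it would contain larger and larger ones.
\<close>

subsection \<open>Edge sets up to isomorphism\<close>

definition jump :: "'a set set \<Rightarrow> 'a set set set" where
  "jump A = {{d, e} | d e. d \<in> A \<and> e \<in> A \<and> d \<inter> e = {}}"

definition two_uniform :: "'a set set \<Rightarrow> bool" where
  "two_uniform A \<longleftrightarrow> finite A \<and> (\<forall>e\<in>A. card e = 2)"

definition isom :: "'a set set \<Rightarrow> 'b set set \<Rightarrow> bool" where
  "isom A B \<longleftrightarrow> (\<exists>f. inj_on f (\<Union>A) \<and> (`) f ` A = B)"

definition embeds :: "'a set set \<Rightarrow> 'b set set \<Rightarrow> bool" where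
  "embeds A B \<longleftrightarrow> (\<exists>C\<subseteq>B. isom A C)"

lemma isomI: "inj_on f (\<Union>A) \<Longrightarrow> (`) f ` A = B \<Longrightarrow> isom A B"
  by (auto simp: isom_def)

lemma isomE:
  assumes "isom A B"
  obtains f where "inj_on f (\<Union>A)" "(`) f ` A = B" "f ` \<Union>A = \<Union>B"
proof -
  obtain f where f: "inj_on f (\<Union>A)" "(`) f ` A = B"
    using assms by (auto simp: isom_def)
  then have "f ` \<Union>A = \<Union>B"
    by auto
  with f show thesis
    by (rule that)
qed

lemma isom_sym:
  assumes "isom A B"
  shows "isom B A"
proof -
  obtain f where f: "inj_on f (\<Union>A)" "(`) f ` A = B" "f ` \<Union>A = \<Union>B"
    using assms by (rule isomE)
  define g where "g = inv_into (\<Union>A) f"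
  have "g ` f ` e = e" if "e \<in> A" for e
    unfolding g_def using f(1) that by (intro inv_into_image_cancel) auto
  then have "(`) g ` B = A"
    using f(2) by (auto simp: image_iff)
  moreover have "inj_on g (\<Union>B)"
    unfolding g_def f(3)[symmetric] by (simp add: inj_on_inv_into)
  ultimately show ?thesis
    by (intro isomI)
qed

lemma isom_trans:
  assumes "isom A B" "isom B C"
  shows "isom A C"
proof -
  obtain f where f: "inj_on f (\<Union>A)" "(`) f ` A = B" "f ` \<Union>A = \<Union>B"
    using assms(1) by (rule isomE)
  obtain g where g: "inj_on g (\<Union>B)" "(`) g ` B = C"
    using assms(2) by (rule isomE)
  have "(`) (g \<circ> f) ` A = C"
    unfolding f(2)[symmetric] g(2)[symmetric] by (simp add: image_image image_comp)
  moreover have "inj_on (g \<circ> f) (\<Union>A)"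
    using f(1,3) g(1) by (simp add: comp_inj_on)
  ultimately show ?thesis
    by (intro isomI)
qed

lemma inj_on_image_edges: "inj_on f (\<Union>A) \<Longrightarrow> inj_on ((`) f) A"
  by (rule inj_onI) (simp add: inj_on_image_eq_iff Union_upper)

lemma isom_card: "isom A B \<Longrightarrow> card A = card B"
  by (auto simp: isom_def card_image inj_on_image_edges)

lemma isom_empty_iff: "isom A B \<Longrightarrow> A = {} \<longleftrightarrow> B = {}"
  by (auto simp: isom_def)

lemma isom_subset:
  assumes "isom A B" "C \<subseteq> A"
  shows "\<exists>D\<subseteq>B. isom C D"
proof -
  obtain f where f: "inj_on f (\<Union>A)" "(`) f ` A = B"
    using assms(1) by (rule isomE)
  have "inj_on f (\<Union>C)"
    using f(1) assms(2) by (meson Union_mono inj_on_subset)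
  then have "isom C ((`) f ` C)"
    by (rule isomI[OF _ refl])
  then show ?thesis
    using image_mono[OF assms(2), of "(`) f"] f(2) by (intro exI[of _ "(`) f ` C"]) simp
qed

lemma embeds_trans:
  assumes "embeds A B" "embeds B C"
  shows "embeds A C"
  using assms isom_subset isom_trans unfolding embeds_def by (metis subset_trans)

lemma isom_imp_embeds: "isom A B \<Longrightarrow> embeds A B"
  by (auto simp: embeds_def)

lemma embeds_refl: "embeds A A"
  by (intro isom_imp_embeds isomI[of "\<lambda>x. x"]) simp_all

lemma isom_if_embeds_card_le:
  assumes "embeds A B" "finite B" "card B \<le> card A"
  shows "isom A B"
proof -
  obtain C where C: "C \<subseteq> B" "isom A C"
    using assms(1) by (auto simp: embeds_def)
  then have "C = B"
    using card_seteq[OF assms(2) C(1)] assms(3) isom_card by metis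
  with C show ?thesis
    by simp
qed

lemma mem_jump_iff: "X \<in> jump A \<longleftrightarrow> (\<exists>d\<in>A. \<exists>e\<in>A. d \<inter> e = {} \<and> X = {d, e})"
  by (auto simp: jump_def)

lemma jumpI: "d \<in> A \<Longrightarrow> e \<in> A \<Longrightarrow> d \<inter> e = {} \<Longrightarrow> {d, e} \<in> jump A"
  unfolding mem_jump_iff by blast

lemma Union_jump_subset: "\<Union>(jump A) \<subseteq> A"
  by (auto simp: jump_def)

lemma jump_mono: "A \<subseteq> B \<Longrightarrow> jump A \<subseteq> jump B"
  by (auto simp: jump_def)

lemma jump_image:
  assumes "inj_on f (\<Union>A)"
  shows "jump ((`) f ` A) = (`) ((`) f) ` jump A"
proof -
  have disjoint: "f ` d \<inter> f ` e = {} \<longleftrightarrow> d \<inter> e = {}" if "d \<in> A" "e \<in> A" for d e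
    using assms that by (metis Union_upper image_is_empty inj_on_image_Int)
  show ?thesis
  proof (rule set_eqI)
    fix X
    have "X \<in> jump ((`) f ` A) \<longleftrightarrow> (\<exists>d\<in>A. \<exists>e\<in>A. f ` d \<inter> f ` e = {} \<and> X = {f ` d, f ` e})"
      unfolding mem_jump_iff by blast
    also have "\<dots> \<longleftrightarrow> (\<exists>d\<in>A. \<exists>e\<in>A. d \<inter> e = {} \<and> X = (`) f ` {d, e})"
      using disjoint by (simp cong: bex_cong)
    also have "\<dots> \<longleftrightarrow> X \<in> (`) ((`) f) ` jump A"
      unfolding image_iff[of X] Bex_def[of "jump A"] mem_jump_iff by blast
    finally show "X \<in> jump ((`) f ` A) \<longleftrightarrow> X \<in> (`) ((`) f) ` jump A" .
  qed
qed

lemma isom_jump: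
  assumes "isom A B"
  shows "isom (jump A) (jump B)"
proof -
  obtain f where f: "inj_on f (\<Union>A)" "(`) f ` A = B"
    using assms by (rule isomE)
  show ?thesis
  proof (rule isomI)
    show "inj_on ((`) f) (\<Union>(jump A))"
      using f(1) by (rule inj_on_subset[OF inj_on_image_edges Union_jump_subset])
    show "(`) ((`) f) ` jump A = jump B"
      using jump_image[OF f(1)] f(2) by simp
  qed
qed

lemma embeds_jump: "embeds A B \<Longrightarrow> embeds (jump A) (jump B)"
  unfolding embeds_def using isom_jump jump_mono by metis

lemma two_uniform_jump:
  assumes "two_uniform A"
  shows "two_uniform (jump A)"
proof -
  have "finite (jump A)"
    by (rule finite_subset[of _ "Pow A"]) (use assms in \<open>auto simp: two_uniform_def jump_def\<close>)
  moreover have "card {d, e} = 2" if "d \<in> A" "d \<inter> e = {}" for d e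
    using that assms by (auto simp: two_uniform_def card_insert_if)
  ultimately show ?thesis
    by (auto simp: two_uniform_def jump_def)
qed

subsection \<open>Growth around a fixed subgraph\<close>

definition degree :: "'a set set \<Rightarrow> 'a \<Rightarrow> nat" where
  "degree A v = card {e \<in> A. v \<in> e}"

definition jump_core :: "'a set set \<Rightarrow> bool" where
  "jump_core C \<longleftrightarrow> isom (jump C) C \<and> 5 \<le> card C \<and> (\<forall>v. degree C v \<le> 3) \<and>
     (\<forall>u v. u \<noteq> v \<longrightarrow> {u, v} \<notin> C \<longrightarrow> degree C u + degree C v \<le> 4)"

lemma degree_eq_0:
  assumes "v \<notin> \<Union>A"
  shows "degree A v = 0"
proof -
  have "{e \<in> A. v \<in> e} = {}"
    using assms by blast
  then show ?thesis
    by (simp only: degree_def card.empty)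
qed

lemma degree_image:
  assumes "inj_on f (\<Union>A)" "v \<in> \<Union>A"
  shows "degree ((`) f ` A) (f v) = degree A v"
proof -
  have "f v \<in> f ` e \<longleftrightarrow> v \<in> e" if "e \<in> A" for e
    using inj_on_image_mem_iff[OF assms] that by blast
  then have "{e \<in> (`) f ` A. f v \<in> e} = (`) f ` {e \<in> A. v \<in> e}"
    by blast
  moreover have "inj_on ((`) f) {e \<in> A. v \<in> e}"
    by (rule inj_on_subset[OF inj_on_image_edges[OF assms(1)]]) simp
  ultimately show ?thesis
    by (simp add: degree_def card_image)
qed

lemma degree_le_isom:
  assumes "isom A B" "\<forall>v. degree A v \<le> k"
  shows "degree B v \<le> k"
proof (cases "v \<in> \<Union>B")
  case True
  obtain f where f: "inj_on f (\<Union>A)" "(`) f ` A = B" "f ` \<Union>A = \<Union>B"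
    using assms(1) by (rule isomE)
  then obtain x where "x \<in> \<Union>A" "v = f x"
    using True by (metis imageE)
  then show ?thesis
    using degree_image[OF f(1)] f(2) assms(2) by auto
qed (simp add: degree_eq_0)

lemma jump_core_isom:
  assumes "jump_core C" "isom C D"
  shows "jump_core D"
proof -
  obtain f where f: "inj_on f (\<Union>C)" "(`) f ` C = D" "f ` \<Union>C = \<Union>D"
    using assms(2) by (rule isomE)
  have isom: "isom (jump D) D"
    using assms isom_jump isom_sym isom_trans unfolding jump_core_def by metis
  have degree_le: "degree D v \<le> 3" for v
    using assms degree_le_isom[OF assms(2), of 3] by (simp add: jump_core_def)
  have "degree D u + degree D v \<le> 4" if "u \<noteq> v" "{u, v} \<notin> D" for u v
  proof (cases "u \<in> \<Union>D \<and> v \<in> \<Union>D")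
    case True
    then obtain x y where xy: "x \<in> \<Union>C" "y \<in> \<Union>C" "u = f x" "v = f y"
      using f(3) by (metis imageE)
    then have "x \<noteq> y" "{x, y} \<notin> C"
      using that f(2) imageI[of "{x, y}" C "(`) f"] by auto
    then show ?thesis
      using assms(1) xy degree_image[OF f(1)] f(2) by (simp add: jump_core_def)
  next
    case False
    then have "degree D u = 0 \<or> degree D v = 0"
      using degree_eq_0[of u D] degree_eq_0[of v D] by auto
    then show ?thesis
      using degree_le[of u] degree_le[of v] by linarith
  qed
  then show ?thesis
    using assms isom degree_le isom_card[OF assms(2)] by (simp add: jump_core_def)
qed

lemma jump_core_jump: "jump_core C \<Longrightarrow> jump_core (jump C)"
  using jump_core_isom[of C "jump C"] isom_sym[of "jump C" C] by (simp add: jump_core_def)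

lemma card_jump_ge:
  assumes "two_uniform A" "C \<subseteq> A"
  shows "card (jump C) + (\<Sum>d\<in>A - C. card {e \<in> C. d \<inter> e = {}}) \<le> card (jump A)"
proof -
  define S where "S = (SIGMA d:A - C. {e \<in> C. d \<inter> e = {}})"
  define N where "N = (\<lambda>(d, e). {d, e}) ` S"
  have finite: "finite C" "finite (A - C)" "finite (jump A)"
    using assms two_uniform_jump[OF assms(1)] by (auto simp: two_uniform_def intro: finite_subset)
  have "inj_on (\<lambda>(d, e). {d, e}) S"
    by (auto simp: S_def inj_on_def doubleton_eq_iff)
  then have "card N = (\<Sum>d\<in>A - C. card {e \<in> C. d \<inter> e = {}})"
    using finite by (simp add: N_def S_def card_image)
  moreover have "jump C \<inter> N = {}"
    using Union_jump_subset[of C] by (auto simp: N_def S_def)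
  moreover have subset: "jump C \<union> N \<subseteq> jump A"
    using jump_mono[OF assms(2)] assms(2) by (auto simp: N_def S_def intro!: jumpI)
  ultimately show ?thesis
    using card_mono[OF finite(3) subset] finite_subset[OF subset finite(3)]
    by (simp add: card_Un_disjoint)
qed

lemma card_le_card_avoiding:
  assumes "finite C"
  shows "card C \<le> card {e \<in> C. {u, v} \<inter> e = {}} + degree C u + degree C v"
proof -
  let ?avoiding = "{e \<in> C. {u, v} \<inter> e = {}}" and ?at = "\<lambda>w. {e \<in> C. w \<in> e}"
  have "card C \<le> card (?avoiding \<union> ?at u \<union> ?at v)"
    using assms by (intro card_mono) auto
  also have "\<dots> \<le> card ?avoiding + card (?at u) + card (?at v)"
    using card_Un_le[of "?avoiding \<union> ?at u" "?at v"] card_Un_le[of ?avoiding "?at u"] by linarith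
  finally show ?thesis
    by (simp add: degree_def)
qed

lemma jump_core_avoiding:
  assumes "jump_core C" "card d = 2" "d \<notin> C"
  shows "0 < card {e \<in> C. d \<inter> e = {}}"
    and "\<not> d \<subseteq> \<Union>C \<Longrightarrow> 1 < card {e \<in> C. d \<inter> e = {}}"
proof -
  obtain u v where d: "d = {u, v}" "u \<noteq> v"
    using assms(2) by (auto simp: card_2_iff)
  have "finite C"
    using assms(1) card.infinite by (fastforce simp: jump_core_def)
  then have lower_bound: "5 \<le> card {e \<in> C. d \<inter> e = {}} + (degree C u + degree C v)"
    using card_le_card_avoiding[of C u v] assms(1) by (simp add: jump_core_def d(1))
  have "degree C u + degree C v \<le> 4"
    using assms(1,3) d by (simp add: jump_core_def)
  with lower_bound show "0 < card {e \<in> C. d \<inter> e = {}}"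
    by linarith
  assume "\<not> d \<subseteq> \<Union>C"
  then have "degree C u = 0 \<or> degree C v = 0"
    using degree_eq_0 d(1) by (metis empty_subsetI insert_subset)
  then have "degree C u + degree C v \<le> 3"
    using assms(1) by (auto simp: jump_core_def)
  with lower_bound show "1 < card {e \<in> C. d \<inter> e = {}}"
    by linarith
qed

lemma card_le_card_jump:
  assumes "jump_core C" "two_uniform A" "C \<subseteq> A"
  shows "card A \<le> card (jump A)"
    and "f \<in> A \<Longrightarrow> \<not> f \<subseteq> \<Union>C \<Longrightarrow> card A < card (jump A)"
proof -
  let ?avoiding = "\<lambda>d. card {e \<in> C. d \<inter> e = {}}"
  have finite: "finite A" "finite C"
    using assms(2,3) by (auto simp: two_uniform_def intro: finite_subset)
  have card_edge: "card d = 2" if "d \<in> A" for d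
    using assms(2) that by (simp add: two_uniform_def)
  have "card (jump C) = card C"
    using assms(1) isom_card[of "jump C" C] by (simp add: jump_core_def)
  then have lower_bound: "card C + sum ?avoiding (A - C) \<le> card (jump A)"
    using card_jump_ge[OF assms(2,3)] by simp
  have card_A: "card A = card C + (\<Sum>d\<in>A - C. 1)"
    using finite assms(3) by (simp add: card_Diff_subset card_mono)
  have pos: "1 \<le> ?avoiding d" if "d \<in> A - C" for d
    using jump_core_avoiding(1)[OF assms(1) card_edge] that by (simp add: Suc_le_eq)
  show "card A \<le> card (jump A)"
    using lower_bound card_A sum_mono[of "A - C" "\<lambda>_. 1" ?avoiding] pos by fastforce
  assume f: "f \<in> A" "\<not> f \<subseteq> \<Union>C"
  then have "f \<in> A - C" "1 < ?avoiding f"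
    using jump_core_avoiding(2)[OF assms(1) card_edge] by blast+
  then have "(\<Sum>d\<in>A - C. 1) < sum ?avoiding (A - C)"
    using finite pos by (intro sum_strict_mono_ex1) auto
  then show "card A < card (jump A)"
    using lower_bound card_A by linarith
qed

text \<open>An edge of \<open>A\<close> joining two vertices of \<open>C\<close> may be disjoint from only one edge of \<open>C\<close>, but in
  the jump graph that pair is an edge leaving the new core.\<close>

lemma jump_core_eq:
  assumes "jump_core C" "two_uniform A" "C \<subseteq> A"
    and "card (jump A) \<le> card A" "card (jump (jump A)) \<le> card (jump A)"
  shows "C = A"
proof (rule ccontr)
  assume "C \<noteq> A"
  then obtain f where f: "f \<in> A" "f \<notin> C"
    using assms(3) by blast
  then have "0 < card {e \<in> C. f \<inter> e = {}}"
    using jump_core_avoiding(1)[OF assms(1)] assms(2) by (simp add: two_uniform_def)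
  then obtain g where g: "g \<in> C" "f \<inter> g = {}"
    by (auto simp: card_gt_0_iff)
  have "{f, g} \<in> jump A"
    using f g assms(3) by (intro jumpI) auto
  moreover have "\<not> {f, g} \<subseteq> \<Union>(jump C)"
    using f(2) Union_jump_subset[of C] by blast
  ultimately have "card (jump A) < card (jump (jump A))"
    by (rule card_le_card_jump(2)[OF jump_core_jump[OF assms(1)] two_uniform_jump[OF assms(2)]
      jump_mono[OF assms(3)]])
  with assms(5) show False
    by simp
qed

locale periodic_jump =
  fixes A :: "nat \<Rightarrow> 'a set set" and p :: nat
  assumes two_uniform: "two_uniform (A k)"
    and isom_Suc: "isom (jump (A k)) (A (Suc k))"
    and isom_period: "isom (A p) (A 0)"
    and period_pos: "p > 0"
    and nonempty: "A 0 \<noteq> {}"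
begin

lemma isom_add_period: "isom (A (k + p)) (A k)"
proof (induction k)
  case (Suc k)
  have "isom (A (Suc k + p)) (jump (A (k + p)))"
    using isom_sym[OF isom_Suc] by simp
  then show ?case
    by (rule isom_trans[OF _ isom_trans[OF isom_jump[OF Suc.IH] isom_Suc]])
qed (use isom_period in simp)

lemma isom_mult_period: "isom (A (Suc n * p)) (A 0)"
proof (induction n)
  case (Suc n)
  have "isom (A (Suc (Suc n) * p)) (A (Suc n * p))"
    using isom_add_period[of "Suc n * p"] by (simp add: algebra_simps)
  then show ?case
    using Suc.IH by (rule isom_trans)
qed (use isom_period in simp)

lemma le_mult_period: "k \<le> Suc k * p"
  using period_pos by (cases p) auto

lemma iterate_nonempty: "A k \<noteq> {}"
proof
  assume "A k = {}"
  have "A i = {}" if "k \<le> i" for i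
    using that
  proof (induction i rule: dec_induct)
    case (step i)
    then show ?case
      using isom_empty_iff[OF isom_Suc[of i]] by (simp add: jump_def)
  qed (rule \<open>A k = {}\<close>)
  then show False
    using isom_empty_iff[OF isom_mult_period] le_mult_period nonempty by blast
qed

lemma embeds_Suc: "embeds B (A k) \<Longrightarrow> embeds (jump B) (A (Suc k))"
  by (rule embeds_trans[OF embeds_jump isom_imp_embeds[OF isom_Suc]])

lemma jump_core_embeds_mono:
  assumes "jump_core C" "embeds C (A k)" "k \<le> i"
  shows "embeds C (A i)"
  using assms(3)
proof (induction i rule: dec_induct)
  case (step i)
  have "isom C (jump C)"
    using assms(1) isom_sym by (auto simp: jump_core_def)
  then show ?case
    by (rule embeds_trans[OF isom_imp_embeds embeds_Suc[OF step.IH]])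
qed (rule assms(2))

lemma card_Suc: "card (A (Suc k)) = card (jump (A k))"
  using isom_card[OF isom_Suc] by simp

lemma card_mono_if_jump_core_embeds:
  assumes "jump_core C" "embeds C (A 0)" "i \<le> j"
  shows "card (A i) \<le> card (A j)"
proof (rule lift_Suc_mono_le[OF _ assms(3)])
  fix i
  obtain D where "D \<subseteq> A i" "isom C D"
    using jump_core_embeds_mono[OF assms(1,2), of i] by (auto simp: embeds_def)
  then show "card (A i) \<le> card (A (Suc i))"
    unfolding card_Suc
    using card_le_card_jump(1)[OF jump_core_isom[OF assms(1)] two_uniform] by blast
qed

lemma isom_if_jump_core_embeds:
  assumes "jump_core C" "embeds C (A k)"
  shows "isom C (A 0)"
proof -
  have "embeds C (A (Suc k * p))"
    using assms le_mult_period by (rule jump_core_embeds_mono)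
  then have embeds_0: "embeds C (A 0)"
    using isom_mult_period by (rule embeds_trans[OF _ isom_imp_embeds])
  note mono = card_mono_if_jump_core_embeds[OF assms(1) embeds_0]
  have "card (A 2) \<le> card (A (Suc 2 * p))"
    by (rule mono[OF le_mult_period])
  also have "\<dots> = card (A 0)"
    by (rule isom_card[OF isom_mult_period])
  finally have "card (A 2) \<le> card (A 0)" .
  moreover have "card (A 0) \<le> card (A 1)" "card (A 1) \<le> card (A 2)"
    by (simp_all add: mono)
  moreover have "card (A 1) = card (jump (A 0))" "card (A 2) = card (jump (jump (A 0)))"
    using card_Suc isom_card[OF isom_jump[OF isom_Suc[of 0]]] by (simp_all add: numeral_2_eq_2)
  moreover obtain D where D: "D \<subseteq> A 0" "isom C D"
    using embeds_0 by (auto simp: embeds_def)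
  ultimately have "D = A 0"
    by (intro jump_core_eq[OF jump_core_isom[OF assms(1) D(2)] two_uniform D(1)]) simp_all
  with D(2) show ?thesis
    by simp
qed

end

subsection \<open>Edge lists\<close>

definition endpoints :: "nat \<times> nat \<Rightarrow> nat set" where
  "endpoints = (\<lambda>(a, b). {a, b})"

definition edge_set :: "(nat \<times> nat) list \<Rightarrow> nat set set" where
  "edge_set E = endpoints ` set E"

definition edge_list :: "(nat \<times> nat) list \<Rightarrow> bool" where
  "edge_list E \<longleftrightarrow> distinct E \<and> set E \<subseteq> {(a, b). a < b}"

lemma endpoints_simp [simp]: "endpoints (a, b) = {a, b}"
  by (simp add: endpoints_def)

lemma edge_set_simps [simp]:
  "edge_set [] = {}"
  "edge_set (d # E) = insert (endpoints d) (edge_set E)"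
  by (simp_all add: edge_set_def)

lemma edge_set_conv_nth: "edge_set E = (\<lambda>i. endpoints (E ! i)) ` {..<length E}"
  by (auto simp: edge_set_def set_conv_nth)

lemma inj_on_endpoints_nth:
  assumes "edge_list E"
  shows "inj_on (\<lambda>i. endpoints (E ! i)) {..<length E}"
proof -
  have "inj_on endpoints {(a, b). a < b}"
    by (auto simp: inj_on_def doubleton_eq_iff)
  then have "inj_on endpoints (set E)"
    by (rule inj_on_subset) (use assms in \<open>simp add: edge_list_def\<close>)
  moreover have "inj_on ((!) E) {..<length E}"
    using assms by (intro inj_on_nth) (auto simp: edge_list_def)
  moreover have "(!) E ` {..<length E} = set E"
    by (auto simp: set_conv_nth)
  ultimately show ?thesis
    using comp_inj_on[of "(!) E" "{..<length E}" endpoints] by (simp add: comp_def)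
qed

lemma finite_edge_set: "finite (edge_set E)"
  by (simp add: edge_set_def)

lemma card_edge_set: "edge_list E \<Longrightarrow> card (edge_set E) = length E"
  by (simp add: edge_set_conv_nth card_image inj_on_endpoints_nth)

fun vertex_bound :: "(nat \<times> nat) list \<Rightarrow> nat" where
  "vertex_bound [] = 0"
| "vertex_bound ((a, b) # E) = max (Suc b) (vertex_bound E)"

lemma less_vertex_bound: "(a, b) \<in> set E \<Longrightarrow> b < vertex_bound E"
  by (induction E rule: vertex_bound.induct) (auto simp: less_max_iff_disj)

lemma Union_edge_set_subset:
  assumes "edge_list E"
  shows "\<Union>(edge_set E) \<subseteq> {..<vertex_bound E}"
proof -
  have "{a, b} \<subseteq> {..<vertex_bound E}" if "(a, b) \<in> set E" for a b
    using less_vertex_bound[OF that] assms that by (fastforce simp: edge_list_def)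
  then show ?thesis
    by (auto simp: edge_set_def)
qed

fun pairs :: "'a list \<Rightarrow> ('a \<times> 'a) list" where
  "pairs [] = []"
| "pairs (x # xs) = map (Pair x) xs @ pairs xs"

lemma set_pairs_subset: "set (pairs xs) \<subseteq> set xs \<times> set xs"
  by (induction xs) auto

lemma distinct_pairs: "distinct xs \<Longrightarrow> distinct (pairs xs)"
  using set_pairs_subset by (induction xs) (fastforce simp: distinct_map inj_on_def)+

lemma set_pairs_sorted:
  fixes xs :: "'a::preorder list"
  shows "sorted_wrt (<) xs \<Longrightarrow> set (pairs xs) = {(x, y). x \<in> set xs \<and> y \<in> set xs \<and> x < y}"
  by (induction xs) (auto dest: less_asym)

lemma set_pairs_upt: "set (pairs [0..<n]) = {(i, j). i < j \<and> j < n}"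
  by (auto simp: set_pairs_sorted)

text \<open>The functions that are run below branch with \<open>if\<close> and \<open>find\<close>, because the simplifier evaluates
  these, unlike \<open>\<and>\<close>, \<open>\<or>\<close> and \<open>list_ex\<close>, lazily.\<close>

fun disjoint_pairs :: "nat \<times> nat \<Rightarrow> nat \<times> nat \<Rightarrow> bool" where
  "disjoint_pairs (a, b) (c, d) =
     (if a = c then False else if a = d then False else if b = c then False else b \<noteq> d)"

definition jump_list :: "(nat \<times> nat) list \<Rightarrow> (nat \<times> nat) list" where
  "jump_list E = filter (\<lambda>(i, j). disjoint_pairs (E ! i) (E ! j)) (pairs [0..<length E])"

lemma disjoint_pairs_iff: "disjoint_pairs d e \<longleftrightarrow> endpoints d \<inter> endpoints e = {}"
  by (cases d; cases e) auto

lemma edge_list_jump_list: "edge_list (jump_list E)"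
  by (auto simp: edge_list_def jump_list_def distinct_pairs set_pairs_upt)

lemma isom_edge_set_jump_list:
  assumes "edge_list E"
  shows "isom (edge_set (jump_list E)) (jump (edge_set E))"
proof (rule isomI)
  let ?f = "\<lambda>i. endpoints (E ! i)" and ?n = "length E"
  have "\<Union>(edge_set (jump_list E)) \<subseteq> {..<?n}"
    by (auto simp: edge_set_def jump_list_def set_pairs_upt)
  with inj_on_endpoints_nth[OF assms] show "inj_on ?f (\<Union>(edge_set (jump_list E)))"
    by (rule inj_on_subset)
  show "(`) ?f ` edge_set (jump_list E) = jump (edge_set E)"
  proof (intro equalityI subsetI)
    fix X assume "X \<in> (`) ?f ` edge_set (jump_list E)"
    then obtain i j where "i < j" "j < ?n" "?f i \<inter> ?f j = {}" "X = {?f i, ?f j}"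
      by (auto simp: edge_set_def jump_list_def set_pairs_upt disjoint_pairs_iff)
    then show "X \<in> jump (edge_set E)"
      by (auto simp: edge_set_conv_nth intro!: jumpI)
  next
    fix X assume "X \<in> jump (edge_set E)"
    then obtain i j where ij: "i < ?n" "j < ?n" "?f i \<inter> ?f j = {}" "X = {?f i, ?f j}"
      by (auto simp: mem_jump_iff edge_set_conv_nth)
    then have "i \<noteq> j"
      by (cases "E ! i") auto
    then have "(min i j, max i j) \<in> set (jump_list E)"
      using ij
      by (auto simp: jump_list_def set_pairs_upt disjoint_pairs_iff min_def max_def Int_commute)
    then have "endpoints (min i j, max i j) \<in> edge_set (jump_list E)"
      unfolding edge_set_def by (rule imageI)
    moreover have "X = ?f ` endpoints (min i j, max i j)"
      using ij(4) by (auto simp: min_def max_def)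
    ultimately show "X \<in> (`) ?f ` edge_set (jump_list E)"
      by (rule rev_image_eqI)
  qed
qed

subsection \<open>Searching for a subgraph\<close>

fun neighbours :: "(nat \<times> nat) list \<Rightarrow> nat \<Rightarrow> nat list" where
  "neighbours [] u = []"
| "neighbours ((a, b) # E) u =
     (if a = u then b # neighbours E u else if b = u then a # neighbours E u else neighbours E u)"

text \<open>The list \<open>xs\<close> holds the images in \<open>E\<close> of the first vertices of the pattern \<open>P\<close>.\<close>

definition candidates :: "(nat \<times> nat) list \<Rightarrow> (nat \<times> nat) list \<Rightarrow> nat list \<Rightarrow> nat list" where
  "candidates P E xs = filter (\<lambda>v. v \<notin> set xs)
     (case map fst (filter (\<lambda>(a, b). b = length xs) P) of
        [] \<Rightarrow> [0..<vertex_bound E]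
      | a # as \<Rightarrow> filter (\<lambda>v. \<forall>a\<in>set as. v \<in> set (neighbours E (xs ! a))) (neighbours E (xs ! a)))"

primrec placeable :: "nat \<Rightarrow> (nat \<times> nat) list \<Rightarrow> (nat \<times> nat) list \<Rightarrow> nat list \<Rightarrow> bool" where
  "placeable 0 P E xs = True"
| "placeable (Suc k) P E xs = (find (\<lambda>v. placeable k P E (xs @ [v])) (candidates P E xs) \<noteq> None)"

definition embeddable :: "(nat \<times> nat) list \<Rightarrow> (nat \<times> nat) list \<Rightarrow> bool" where
  "embeddable P E = placeable (vertex_bound P) P E []"

definition placement :: "(nat \<times> nat) list \<Rightarrow> (nat \<times> nat) list \<Rightarrow> nat list \<Rightarrow> bool" where
  "placement P E xs \<longleftrightarrow> distinct xs \<and>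
     (\<forall>(a, b)\<in>set P. b < length xs \<longrightarrow> {xs ! a, xs ! b} \<in> edge_set E)"

lemma mem_neighbours: "v \<in> set (neighbours E u) \<Longrightarrow> {u, v} \<in> edge_set E"
  by (induction E u rule: neighbours.induct) (auto split: if_splits)

lemma candidates_adjacent:
  assumes "v \<in> set (candidates P E xs)" "(a, length xs) \<in> set P"
  shows "{xs ! a, v} \<in> edge_set E"
proof -
  let ?placed = "map fst (filter (\<lambda>(a, b). b = length xs) P)"
  have placed: "a \<in> set ?placed"
    using assms(2) by force
  have "v \<in> set (neighbours E (xs ! a))"
  proof (cases ?placed)
    case Nil
    then show ?thesis
      using placed unfolding Nil by simp
  next
    case (Cons b bs)
    then show ?thesis
      using assms(1) placed unfolding candidates_def Cons by auto
  qed
  then show ?thesis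
    by (rule mem_neighbours)
qed

lemma placement_snoc:
  assumes "edge_list P" "placement P E xs" "v \<in> set (candidates P E xs)"
  shows "placement P E (xs @ [v])"
proof -
  have "{(xs @ [v]) ! a, (xs @ [v]) ! b} \<in> edge_set E" if "(a, b) \<in> set P" "b \<le> length xs" for a b
  proof -
    have "a < b"
      using assms(1) that(1) by (auto simp: edge_list_def)
    then show ?thesis
      using assms(2) candidates_adjacent[OF assms(3)] that
      by (cases "b = length xs") (auto simp: nth_append placement_def)
  qed
  moreover have "v \<notin> set xs"
    using assms(3) by (simp add: candidates_def)
  ultimately show ?thesis
    using assms(2) by (auto simp: placement_def)
qed

lemma placeable_imp_placement:
  assumes "edge_list P" "placeable k P E xs" "placement P E xs"
  shows "\<exists>ys. length ys = length xs + k \<and> placement P E ys"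
  using assms(2,3)
proof (induction k arbitrary: xs)
  case (Suc k)
  then obtain v where v: "v \<in> set (candidates P E xs)" "placeable k P E (xs @ [v])"
    by (auto simp: find_None_iff)
  then show ?case
    using Suc.IH[OF v(2) placement_snoc[OF assms(1) Suc.prems(2) v(1)]] by simp
qed auto

lemma embeds_if_embeddable:
  assumes "embeddable P E" "edge_list P"
  shows "embeds (edge_set P) (edge_set E)"
proof -
  have "placement P E []"
    by (simp add: placement_def)
  then obtain ys where ys: "length ys = vertex_bound P" "placement P E ys"
    using placeable_imp_placement[OF assms(2)] assms(1) unfolding embeddable_def by fastforce
  have "inj_on ((!) ys) {..<vertex_bound P}"
    using ys by (intro inj_on_nth) (auto simp: placement_def)
  then have "inj_on ((!) ys) (\<Union>(edge_set P))"
    by (rule inj_on_subset[OF _ Union_edge_set_subset[OF assms(2)]])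
  moreover have "(`) ((!) ys) ` edge_set P \<subseteq> edge_set E"
    using ys less_vertex_bound by (fastforce simp: edge_set_def[of P] placement_def)
  moreover from calculation(1) have "isom (edge_set P) ((`) ((!) ys) ` edge_set P)"
    by (rule isomI[OF _ refl])
  ultimately show ?thesis
    unfolding embeds_def by (intro exI conjI)
qed

subsection \<open>Adding an edge\<close>

definition extensions :: "(nat \<times> nat) list \<Rightarrow> (nat \<times> nat) list list" where
  "extensions E = (let n = vertex_bound E in
     map (\<lambda>d. d # E) (filter (\<lambda>d. d \<notin> set E) ((n, Suc n) # pairs [0..<Suc n])))"

primrec edge_lists :: "nat \<Rightarrow> (nat \<times> nat) list list" where
  "edge_lists 0 = [[]]"
| "edge_lists (Suc n) = concat (map extensions (edge_lists n))"

lemma set_extensions: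
  "set (extensions E) = (\<lambda>d. d # E) `
     ({(a, b). a < b \<and> (b \<le> vertex_bound E \<or> a = vertex_bound E \<and> b = Suc a)} - set E)"
  by (auto simp: extensions_def Let_def set_pairs_upt simp del: upt_Suc)

lemma edge_list_extensions: "edge_list E \<Longrightarrow> F \<in> set (extensions E) \<Longrightarrow> edge_list F"
  by (auto simp: set_extensions edge_list_def)

lemma edge_list_edge_lists: "E \<in> set (edge_lists n) \<Longrightarrow> edge_list E"
proof (induction n arbitrary: E)
  case 0
  then show ?case
    by (simp add: edge_list_def)
next
  case (Suc n)
  then show ?case
    using edge_list_extensions by auto
qed

lemma inj_on_extend:
  fixes V :: "nat set"
  assumes "inj_on f V" "V \<subseteq> {..<n}"
  obtains a g where "a \<in> V \<or> a = n" "inj_on g (insert a V)" "\<forall>x\<in>V. g x = f x" "g a = u"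
proof (cases "u \<in> f ` V")
  case True
  then obtain a where "a \<in> V" "u = f a"
    by blast
  then show thesis
    using that[of a f] assms(1) by (simp add: insert_absorb)
next
  case False
  have "n \<notin> V"
    using assms(2) by auto
  then have "\<forall>x\<in>V. (f(n := u)) x = f x" "inj_on (f(n := u)) (insert n V)"
    using assms(1) False by (auto simp: inj_on_def)
  then show thesis
    using that[of n "f(n := u)"] by simp
qed

lemma inj_on_extend_pair:
  fixes V :: "nat set"
  assumes "inj_on f V" "V \<subseteq> {..<n}" "u \<noteq> v"
  obtains a b g where "a < b" "b \<le> n \<or> a = n \<and> b = Suc n"
    "inj_on g (insert a (insert b V))" "\<forall>x\<in>V. g x = f x" "g ` {a, b} = {u, v}"
proof -
  obtain a g where g: "a \<in> V \<or> a = n" "inj_on g (insert a V)" "\<forall>x\<in>V. g x = f x" "g a = u"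
    using inj_on_extend[OF assms(1,2)] by blast
  define m where "m = (if a = n then Suc n else n)"
  have "insert a V \<subseteq> {..<m}"
    using g(1) assms(2) by (auto simp: m_def)
  then obtain b h where h: "b \<in> insert a V \<or> b = m" "inj_on h (insert b (insert a V))"
      "\<forall>x\<in>insert a V. h x = g x" "h b = v"
    using inj_on_extend[OF g(2)] by blast
  have image: "h a = u" "a \<noteq> b"
    using g(4) h(3,4) assms(3) by auto
  have bounds: "a < n \<or> a = n" "b < n \<or> b = n \<or> a = n \<and> b = Suc n"
    using g(1) h(1) assms(2) by (auto simp: m_def split: if_splits)
  show thesis
  proof (rule that[of "min a b" "max a b" h])
    show "max a b \<le> n \<or> min a b = n \<and> max a b = Suc n"
      using bounds by auto
    show "inj_on h (insert (min a b) (insert (max a b) V))"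
      using h(2) by (cases "a \<le> b") (simp_all only: min_def max_def insert_commute if_True if_False)
  qed (use image g(3) h(3,4) in \<open>auto simp: min_def max_def\<close>)
qed

lemma ex_extension_isom:
  assumes "edge_list E" "isom (edge_set E) A" "card e = 2" "e \<notin> A"
  shows "\<exists>F\<in>set (extensions E). isom (edge_set F) (insert e A)"
proof -
  obtain f where f: "inj_on f (\<Union>(edge_set E))" "(`) f ` edge_set E = A"
    using assms(2) by (rule isomE)
  obtain u v where e: "e = {u, v}" "u \<noteq> v"
    using assms(3) by (auto simp: card_2_iff)
  obtain a b g where ab: "a < b"
      "b \<le> vertex_bound E \<or> a = vertex_bound E \<and> b = Suc (vertex_bound E)"
    and g: "inj_on g (insert a (insert b (\<Union>(edge_set E))))" "\<forall>x\<in>\<Union>(edge_set E). g x = f x"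
      "g ` {a, b} = {u, v}"
    by (rule inj_on_extend_pair[OF f(1) Union_edge_set_subset[OF assms(1)] e(2)])
  have image: "(`) g ` edge_set E = A"
    unfolding f(2)[symmetric] using g(2) by (intro image_cong refl) auto
  have "isom (edge_set ((a, b) # E)) (insert e A)"
    using g(1,3) image e(1) by (intro isomI[of g]) simp_all
  moreover have "{a, b} \<notin> edge_set E"
    using image g(3) e(1) assms(4) by (metis imageI)
  then have "(a, b) \<notin> set E"
    by (force simp: edge_set_def)
  then have "(a, b) # E \<in> set (extensions E)"
    using ab by (auto simp: set_extensions)
  ultimately show ?thesis
    by blast
qed

lemma edge_lists_complete:
  assumes "two_uniform A"
  shows "\<exists>E\<in>set (edge_lists (card A)). isom (edge_set E) A"
proof -
  have "finite A"
    using assms by (simp add: two_uniform_def)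
  then show ?thesis
    using assms
  proof (induction A rule: finite_induct)
    case (insert e A)
    then obtain E where E: "E \<in> set (edge_lists (card A))" "isom (edge_set E) A"
      by (auto simp: two_uniform_def)
    have "card e = 2"
      using insert.prems by (simp add: two_uniform_def)
    then obtain F where "F \<in> set (extensions E)" "isom (edge_set F) (insert e A)"
      using ex_extension_isom[OF edge_list_edge_lists[OF E(1)] E(2)] insert.hyps(2) by blast
    then show ?case
      using E(1) insert.hyps by auto
  qed (auto simp: isom_def)
qed

lemma ex_extension_embeds:
  assumes "edge_list E" "two_uniform A" "embeds (edge_set E) A" "\<not> isom (edge_set E) A"
  shows "\<exists>F\<in>set (extensions E). embeds (edge_set F) A"
proof -
  obtain C where C: "C \<subseteq> A" "isom (edge_set E) C"
    using assms(3) by (auto simp: embeds_def)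
  then have "C \<noteq> A"
    using assms(4) by auto
  then obtain e where e: "e \<in> A" "e \<notin> C"
    using C(1) by blast
  then have "card e = 2"
    using assms(2) by (simp add: two_uniform_def)
  then obtain F where "F \<in> set (extensions E)" "isom (edge_set F) (insert e C)"
    using ex_extension_isom[OF assms(1) C(2)] e(2) by blast
  moreover have "insert e C \<subseteq> A"
    using C(1) e(1) by simp
  ultimately show ?thesis
    unfolding embeds_def by blast
qed

subsection \<open>The search\<close>

definition five_cycle :: "(nat \<times> nat) list" where
  "five_cycle = [(0, 1), (1, 2), (2, 3), (3, 4), (0, 4)]"

definition net :: "(nat \<times> nat) list" where
  "net = [(0, 1), (1, 2), (0, 2), (0, 3), (1, 4), (2, 5)]"

lemma edge_list_five_cycle: "edge_list five_cycle"
  by (simp add: edge_list_def five_cycle_def)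

lemma edge_list_net: "edge_list net"
  by (simp add: edge_list_def net_def)

lemma isom_jump_if_embeddable:
  assumes "edge_list E" "embeddable E (jump_list E)" "length (jump_list E) = length E"
  shows "isom (jump (edge_set E)) (edge_set E)"
proof -
  have "isom (edge_set E) (edge_set (jump_list E))"
    using embeds_if_embeddable[OF assms(2,1)] assms
    by (intro isom_if_embeds_card_le)
      (simp_all add: finite_edge_set card_edge_set edge_list_jump_list)
  then show ?thesis
    using isom_edge_set_jump_list[OF assms(1)] isom_sym isom_trans by blast
qed

lemma degree_edge_set:
  assumes "edge_list E"
  shows "degree (edge_set E) v = length (filter (\<lambda>(a, b). v = a \<or> v = b) E)"
proof -
  have "{e \<in> edge_set E. v \<in> e} = edge_set (filter (\<lambda>(a, b). v = a \<or> v = b) E)"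
    by (auto simp: edge_set_def endpoints_def)
  moreover have "edge_list (filter (\<lambda>(a, b). v = a \<or> v = b) E)"
    using assms by (auto simp: edge_list_def)
  ultimately show ?thesis
    by (simp add: degree_def card_edge_set)
qed

lemma jump_core_five_cycle: "jump_core (edge_set five_cycle)"
proof -
  let ?degree = "degree (edge_set five_cycle)"
  have degree_le_2: "?degree v \<le> 2" for v
    by (simp add: degree_edge_set edge_list_five_cycle) (simp add: five_cycle_def)
  have "?degree u + ?degree v \<le> 4" for u v
    using degree_le_2[of u] degree_le_2[of v] by linarith
  moreover have "?degree v \<le> 3" for v
    using degree_le_2[of v] by linarith
  moreover have "isom (jump (edge_set five_cycle)) (edge_set five_cycle)"
    by (rule isom_jump_if_embeddable[OF edge_list_five_cycle]) code_simp+
  moreover have "card (edge_set five_cycle) = 5"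
    by (simp add: card_edge_set edge_list_five_cycle) (simp add: five_cycle_def)
  ultimately show ?thesis
    by (simp add: jump_core_def)
qed

lemma jump_core_net: "jump_core (edge_set net)"
proof -
  let ?degree = "degree (edge_set net)" and ?triangle = "{0, 1, 2} :: nat set"
  have degree_le_3: "?degree v \<le> 3" for v
    unfolding degree_edge_set[OF edge_list_net] unfolding net_def
    by (cases "v \<in> {0, 1, 2, 3, 4, 5}") auto
  have degree_le_1: "?degree v \<le> 1" if "v \<notin> ?triangle" for v
    using that unfolding degree_edge_set[OF edge_list_net] unfolding net_def
    by (cases "v \<in> {3, 4, 5}") auto
  have adjacent: "{u, v} \<in> edge_set net" if "u \<in> ?triangle" "v \<in> ?triangle" "u \<noteq> v" for u v
    using that by (elim insertE emptyE) (simp_all add: net_def doubleton_eq_iff)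
  have "?degree u + ?degree v \<le> 4" if "u \<noteq> v" "{u, v} \<notin> edge_set net" for u v
  proof -
    have "?degree u \<le> 1 \<or> ?degree v \<le> 1"
      using adjacent degree_le_1 that by blast
    then show ?thesis
      using degree_le_3[of u] degree_le_3[of v] by linarith
  qed
  moreover have "isom (jump (edge_set net)) (edge_set net)"
    by (rule isom_jump_if_embeddable[OF edge_list_net]) code_simp+
  moreover have "card (edge_set net) = 6"
    by (simp add: card_edge_set edge_list_net) (simp add: net_def)
  ultimately show ?thesis
    using degree_le_3 by (simp add: jump_core_def)
qed

fun reaches_core :: "nat \<Rightarrow> (nat \<times> nat) list \<Rightarrow> bool" where
  "reaches_core 0 E = (if embeddable five_cycle E then True else embeddable net E)"
| "reaches_core (Suc k) E = (if reaches_core 0 E then True else reaches_core k (jump_list E))"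

text \<open>All lists in one call of \<open>representatives\<close> have equally many edges, so that \<open>embeddable\<close>
  amounts to isomorphic. The bounds 4 and 6 are the least for which the search succeeds.\<close>

fun representatives :: "(nat \<times> nat) list list \<Rightarrow> (nat \<times> nat) list list" where
  "representatives [] = []"
| "representatives (E # L) =
     (if reaches_core 4 E then representatives L
      else let R = representatives L in
        if find (\<lambda>S. embeddable S E) R \<noteq> None then R else E # R)"

primrec dies_within :: "nat \<Rightarrow> (nat \<times> nat) list \<Rightarrow> bool" where
  "dies_within 0 E \<longleftrightarrow> E = []"
| "dies_within (Suc k) E \<longleftrightarrow> (if E = [] then True else dies_within k (jump_list E))"

primrec search_closes :: "nat \<Rightarrow> (nat \<times> nat) list list \<Rightarrow> bool" where
  "search_closes 0 L \<longleftrightarrow> L = []"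
| "search_closes (Suc n) L \<longleftrightarrow> (let R = representatives L in
     if list_all (dies_within 6) R then search_closes n (concat (map extensions R)) else False)"

lemma set_representatives_subset: "set (representatives L) \<subseteq> set L"
  by (induction L) (auto simp: Let_def)

lemma representatives_cases:
  assumes "E \<in> set L" "\<forall>E\<in>set L. edge_list E"
  obtains (reaches_core) "reaches_core 4 E"
  | (representative) S where "S \<in> set (representatives L)" "embeds (edge_set S) (edge_set E)"
proof -
  have "reaches_core 4 E \<or> (\<exists>S\<in>set (representatives L). S = E \<or> embeddable S E)"
    using assms(1) by (induction L) (auto simp: Let_def find_None_iff)
  then show thesis
    using that embeds_if_embeddable embeds_refl assms(2) set_representatives_subset by blast
qed

lemma search_closes_edge_lists_4:
  "search_closes 4 (filter (\<lambda>E. jump_list (jump_list E) \<noteq> []) (edge_lists 4))"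
  by code_simp

context periodic_jump
begin

definition starts_at_core :: bool where
  "starts_at_core \<longleftrightarrow> isom (edge_set five_cycle) (A 0) \<or> isom (edge_set net) (A 0)"

lemma embeds_jump_list:
  assumes "edge_list E" "embeds (edge_set E) (A k)"
  shows "embeds (edge_set (jump_list E)) (A (Suc k))"
  by (rule embeds_trans[OF isom_imp_embeds[OF isom_edge_set_jump_list[OF assms(1)]]
      embeds_Suc[OF assms(2)]])

lemma isom_jump_list:
  assumes "edge_list E" "isom (edge_set E) (A k)"
  shows "isom (edge_set (jump_list E)) (A (Suc k))"
  by (rule isom_trans[OF isom_edge_set_jump_list[OF assms(1)]
      isom_trans[OF isom_jump[OF assms(2)] isom_Suc]])

lemma not_isom_if_dies_within:
  assumes "dies_within n E" "edge_list E"
  shows "\<not> isom (edge_set E) (A k)"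
  using assms
proof (induction n arbitrary: E k)
  case 0
  then show ?case
    using isom_empty_iff iterate_nonempty by fastforce
next
  case (Suc n)
  show ?case
  proof (cases "E = []")
    case True
    then show ?thesis
      using isom_empty_iff iterate_nonempty by fastforce
  next
    case False
    then show ?thesis
      using Suc edge_list_jump_list isom_jump_list by (metis dies_within.simps(2))
  qed
qed

lemma starts_at_core_if_embeddable:
  assumes "embeddable five_cycle E \<or> embeddable net E" "embeds (edge_set E) (A k)"
  shows "starts_at_core"
  using assms embeds_trans embeds_if_embeddable edge_list_five_cycle edge_list_net
    isom_if_jump_core_embeds jump_core_five_cycle jump_core_net
  unfolding starts_at_core_def by metis

lemma starts_at_core_if_reaches_core:
  assumes "reaches_core m E" "edge_list E" "embeds (edge_set E) (A k)"
  shows "starts_at_core"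
  using assms
proof (induction m E arbitrary: k rule: reaches_core.induct)
  case (1 E)
  then show ?case
    using starts_at_core_if_embeddable by (auto split: if_splits)
next
  case (2 m E)
  then show ?case
    using starts_at_core_if_embeddable embeds_jump_list edge_list_jump_list
    by (metis reaches_core.simps)
qed

lemma starts_at_core_if_search_closes:
  assumes "search_closes n L" "\<forall>E\<in>set L. edge_list E" "E \<in> set L" "embeds (edge_set E) (A 0)"
  shows "starts_at_core"
  using assms
proof (induction n arbitrary: L E)
  case (Suc n)
  let ?R = "representatives L"
  have closes: "search_closes n (concat (map extensions ?R))"
    and dies: "\<forall>S\<in>set ?R. dies_within 6 S"
    using Suc.prems(1) by (auto simp: Let_def list_all_iff split: if_splits)
  have R: "\<forall>S\<in>set ?R. edge_list S"
    using Suc.prems(2) set_representatives_subset by blast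
  show ?case
    using Suc.prems(3,2)
  proof (cases rule: representatives_cases)
    case reaches_core
    then show ?thesis
      using starts_at_core_if_reaches_core Suc.prems by blast
  next
    case (representative S)
    then have "embeds (edge_set S) (A 0)"
      using embeds_trans Suc.prems(4) by blast
    moreover have "\<not> isom (edge_set S) (A 0)"
      using not_isom_if_dies_within R dies representative(1) by blast
    ultimately obtain F where "F \<in> set (extensions S)" "embeds (edge_set F) (A 0)"
      using ex_extension_embeds two_uniform R representative(1) by blast
    moreover have "\<forall>F\<in>set (concat (map extensions ?R)). edge_list F"
      using edge_list_extensions R by auto
    ultimately show ?thesis
      using Suc.IH[OF closes] representative(1) by auto
  qed
qed simp

lemma ex_four_edges: "\<exists>C\<subseteq>A 0. card C = 4 \<and> jump (jump C) \<noteq> {}"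
proof -
  have "jump (jump (A 0)) \<noteq> {}"
    using iterate_nonempty[of "Suc (Suc 0)"] isom_empty_iff[OF isom_Suc]
      isom_empty_iff[OF isom_jump[OF isom_Suc]] by blast
  then obtain X Y where "X \<in> jump (A 0)" "Y \<in> jump (A 0)" and XY: "X \<inter> Y = {}"
    by (auto simp: mem_jump_iff[of _ "jump _"])
  then obtain a b c d where abcd: "a \<in> A 0" "b \<in> A 0" "c \<in> A 0" "d \<in> A 0" "a \<inter> b = {}" "c \<inter> d = {}"
    and X: "X = {a, b}" "Y = {c, d}"
    by (auto simp: mem_jump_iff)
  have "a \<noteq> b" "c \<noteq> d"
    using abcd two_uniform[of 0] by (auto simp: two_uniform_def)
  then have "distinct [a, b, c, d]"
    using XY X by auto
  then have "card {a, b, c, d} = 4"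
    using distinct_card[of "[a, b, c, d]"] by simp
  moreover have "X \<in> jump {a, b, c, d}" "Y \<in> jump {a, b, c, d}"
    using abcd X by (auto intro: jumpI)
  then have "jump (jump {a, b, c, d}) \<noteq> {}"
    using jumpI XY by (metis empty_iff)
  ultimately show ?thesis
    using abcd by (intro exI[of _ "{a, b, c, d}"]) simp
qed

lemma isom_five_cycle_or_net: "isom (edge_set five_cycle) (A 0) \<or> isom (edge_set net) (A 0)"
proof -
  obtain C where C: "C \<subseteq> A 0" "card C = 4" "jump (jump C) \<noteq> {}"
    using ex_four_edges by blast
  then have "two_uniform C"
    using two_uniform[of 0] by (auto simp: two_uniform_def intro: finite_subset)
  then obtain E where E: "E \<in> set (edge_lists 4)" "isom (edge_set E) C"
    using edge_lists_complete C(2) by force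
  then have "edge_list E"
    using edge_list_edge_lists by blast
  then have "isom (edge_set (jump_list (jump_list E))) (jump (jump C))"
    using E(2) edge_list_jump_list isom_edge_set_jump_list isom_jump isom_trans by metis
  then have "jump_list (jump_list E) \<noteq> []"
    using C(3) isom_empty_iff by fastforce
  moreover have "embeds (edge_set E) (A 0)"
    using E(2) C(1) by (auto simp: embeds_def)
  ultimately show ?thesis
    using starts_at_core_if_search_closes[OF search_closes_edge_lists_4] E(1) edge_list_edge_lists
    by (auto simp: starts_at_core_def)
qed

end

subsection \<open>Jump graphs\<close>

lemma del_isolated_eq:
  "finite_simple_graph G \<Longrightarrow> del_isolated G = \<lparr>vertices = \<Union>(edges G), edges = edges G\<rparr>"
  by (auto simp: del_isolated_def finite_simple_graph_def)

lemma finite_simple_graph_del_isolated: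
  "finite_simple_graph G \<Longrightarrow> finite_simple_graph (del_isolated G)"
  by (auto simp: del_isolated_def finite_simple_graph_def)

lemma two_uniform_edges:
  assumes "finite_simple_graph G"
  shows "two_uniform (edges G)"
proof -
  have "edges G \<subseteq> Pow (vertices G)"
    using assms by (auto simp: finite_simple_graph_def)
  then show ?thesis
    using assms finite_subset by (auto simp: finite_simple_graph_def two_uniform_def)
qed

lemma edges_jump_graph: "edges (jump_graph G) = jump (edges G)"
  by (simp add: jump_graph_def jump_def)

lemma isom_edges_relabel:
  assumes "finite_simple_graph G" "inj_on f (vertices G)"
  shows "isom (edges G) (edges (relabel f G))"
proof (rule isomI)
  show "inj_on f (\<Union>(edges G))"
    by (rule inj_on_subset[OF assms(2)]) (use assms(1) in \<open>auto simp: finite_simple_graph_def\<close>)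
qed (simp add: relabel_def)

lemma image_edges_if_adjacency:
  assumes "two_uniform A" "two_uniform B" "f ` \<Union>A = \<Union>B"
    and "\<forall>u\<in>\<Union>A. \<forall>v\<in>\<Union>A. {u, v} \<in> A \<longleftrightarrow> {f u, f v} \<in> B"
  shows "(`) f ` A = B"
proof (intro equalityI subsetI)
  fix e assume "e \<in> (`) f ` A"
  then obtain d where d: "d \<in> A" "e = f ` d"
    by blast
  then obtain u v where uv: "d = {u, v}"
    using assms(1) by (auto simp: two_uniform_def card_2_iff)
  then have "u \<in> \<Union>A" "v \<in> \<Union>A"
    using d(1) by auto
  then show "e \<in> B"
    using d uv assms(4) by simp
next
  fix e assume e: "e \<in> B"
  then obtain x y where xy: "e = {x, y}"
    using assms(2) by (meson card_2_iff two_uniform_def)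
  then have "x \<in> f ` \<Union>A" "y \<in> f ` \<Union>A"
    using e assms(3) by auto
  then obtain u v where uv: "u \<in> \<Union>A" "v \<in> \<Union>A" "x = f u" "y = f v"
    by blast
  then have "{u, v} \<in> A"
    using e xy assms(4) by blast
  moreover have "e = f ` {u, v}"
    using uv xy by simp
  ultimately show "e \<in> (`) f ` A"
    by blast
qed

lemma graph_eq_iff_isom:
  assumes "finite_simple_graph G" "finite_simple_graph H"
  shows "G \<simeq>\<^sub>g H \<longleftrightarrow> isom (edges G) (edges H)"
proof
  assume "G \<simeq>\<^sub>g H"
  then obtain f where f: "bij_betw f (\<Union>(edges G)) (\<Union>(edges H))"
    "\<forall>u\<in>\<Union>(edges G). \<forall>v\<in>\<Union>(edges G). {u, v} \<in> edges G \<longleftrightarrow> {f u, f v} \<in> edges H"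
    using assms by (auto simp: graph_eq_def graph_iso_def del_isolated_eq)
  then have "(`) f ` edges G = edges H"
    using assms
    by (intro image_edges_if_adjacency) (simp_all add: two_uniform_edges bij_betw_imp_surj_on)
  with f(1) show "isom (edges G) (edges H)"
    by (intro isomI) (simp_all add: bij_betw_imp_inj_on)
next
  assume "isom (edges G) (edges H)"
  then obtain f where f: "inj_on f (\<Union>(edges G))" "(`) f ` edges G = edges H"
    "f ` \<Union>(edges G) = \<Union>(edges H)"
    by (rule isomE)
  then have "relabel f (del_isolated G) = del_isolated H"
    using assms by (simp add: relabel_def del_isolated_eq)
  moreover have "inj_on f (vertices (del_isolated G))"
    using assms(1) f(1) by (simp add: del_isolated_eq)
  ultimately show "G \<simeq>\<^sub>g H"
    using graph_iso_relabel[OF finite_simple_graph_del_isolated[OF assms(1)]]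
    unfolding graph_eq_def by metis
qed

lemma isom_edges_jump_iter_0:
  "finite_simple_graph G \<Longrightarrow> isom (edges G) (edges (jump_iter 0 G))"
  by (simp add: isom_edges_relabel inj_on_Orig)

lemma isom_edges_jump_iter_Suc:
  assumes "finite_simple_graph G"
  shows "isom (jump (edges (jump_iter k G))) (edges (jump_iter (Suc k) G))"
proof -
  have "finite_simple_graph (jump_iter k G)"
    by (rule finite_simple_graph_jump_iter[OF assms])
  then show ?thesis
    using isom_edges_relabel[OF finite_simple_graph_jump inj_on_Edge_Abs_fset]
    by (simp add: edges_jump_graph)
qed

lemma jump_graph_eq_iff:
  "finite_simple_graph G \<Longrightarrow> jump_graph G \<simeq>\<^sub>g G \<longleftrightarrow> isom (jump (edges G)) (edges G)"
  by (simp add: graph_eq_iff_isom finite_simple_graph_jump edges_jump_graph)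

lemma jump_iter_eq_iff:
  "finite_simple_graph G \<Longrightarrow> jump_iter k G \<simeq>\<^sub>g G \<longleftrightarrow> isom (edges (jump_iter k G)) (edges G)"
  by (rule graph_eq_iff_isom[OF finite_simple_graph_jump_iter])

lemma jump_iter_1_eq_if_jump_graph_eq:
  assumes "finite_simple_graph G" "jump_graph G \<simeq>\<^sub>g G"
  shows "jump_iter 1 G \<simeq>\<^sub>g G"
proof -
  have "isom (jump (edges G)) (edges (jump_iter 1 G))"
    using isom_trans[OF isom_jump[OF isom_edges_jump_iter_0] isom_edges_jump_iter_Suc] assms(1)
    unfolding One_nat_def by blast
  then show ?thesis
    using assms isom_sym isom_trans
    unfolding jump_graph_eq_iff[OF assms(1)] jump_iter_eq_iff[OF assms(1)] by blast
qed

lemma graph_eq_C5_iff: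
  assumes "finite_simple_graph G"
  shows "G \<simeq>\<^sub>g C5 \<longleftrightarrow> isom (edge_set five_cycle) (edges G)"
proof -
  have "edges C5 = edge_set five_cycle" "finite_simple_graph C5"
    by (simp_all add: C5_def five_cycle_def insert_commute finite_simple_graph_def)
  then show ?thesis
    using graph_eq_iff_isom[OF assms] isom_sym by metis
qed

lemma graph_eq_net_graph_iff:
  assumes "finite_simple_graph G"
  shows "G \<simeq>\<^sub>g net_graph \<longleftrightarrow> isom (edge_set net) (edges G)"
proof -
  have "edges net_graph = edge_set net" "finite_simple_graph net_graph"
    by (simp_all add: net_graph_def net_def insert_commute finite_simple_graph_def)
  then show ?thesis
    using graph_eq_iff_isom[OF assms] isom_sym by metis
qed

lemma periodic_jump_jump_iter:
  assumes "finite_simple_graph G" "edges G \<noteq> {}" "p \<ge> 1" "jump_iter p G \<simeq>\<^sub>g G"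
  shows "periodic_jump (\<lambda>k. edges (jump_iter k G)) p"
proof
  show "two_uniform (edges (jump_iter k G))" for k
    by (rule two_uniform_edges[OF finite_simple_graph_jump_iter[OF assms(1)]])
  show "isom (jump (edges (jump_iter k G))) (edges (jump_iter (Suc k) G))" for k
    by (rule isom_edges_jump_iter_Suc[OF assms(1)])
  have "isom (edges (jump_iter p G)) (edges G)"
    using assms(1,4) by (simp only: jump_iter_eq_iff)
  then show "isom (edges (jump_iter p G)) (edges (jump_iter 0 G))"
    by (rule isom_trans[OF _ isom_edges_jump_iter_0[OF assms(1)]])
  show "edges (jump_iter 0 G) \<noteq> {}"
    using assms(2) isom_empty_iff[OF isom_edges_jump_iter_0[OF assms(1)]] by simp
qed (use assms(3) in simp)

lemma C5_or_net_if_jump_iter_eq: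
  assumes "finite_simple_graph G" "edges G \<noteq> {}" "k \<ge> 1" "jump_iter k G \<simeq>\<^sub>g G"
  shows "G \<simeq>\<^sub>g C5 \<or> G \<simeq>\<^sub>g net_graph"
proof -
  interpret periodic_jump "\<lambda>k. edges (jump_iter k G)" k
    using assms by (rule periodic_jump_jump_iter)
  show ?thesis
    unfolding graph_eq_C5_iff[OF assms(1)] graph_eq_net_graph_iff[OF assms(1)]
    using isom_five_cycle_or_net isom_trans[OF _ isom_sym[OF isom_edges_jump_iter_0[OF assms(1)]]]
    by blast
qed

lemma jump_graph_eq_if_C5_or_net:
  assumes "finite_simple_graph G" "G \<simeq>\<^sub>g C5 \<or> G \<simeq>\<^sub>g net_graph"
  shows "jump_graph G \<simeq>\<^sub>g G"
proof -
  have "jump_core (edges G)"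
    using assms jump_core_isom jump_core_five_cycle jump_core_net
    by (auto simp: graph_eq_C5_iff graph_eq_net_graph_iff)
  then show ?thesis
    using assms(1) by (simp add: jump_graph_eq_iff jump_core_def)
qed

theorem mainTheorem3:
  fixes G :: "'a ugraph"
  assumes "finite_simple_graph G"
    and "edges G \<noteq> {}"
  shows "(jump_graph G \<simeq>\<^sub>g G \<longleftrightarrow> (\<exists>k\<ge>1. jump_iter k G \<simeq>\<^sub>g G))
    \<and> ((\<exists>k\<ge>1. jump_iter k G \<simeq>\<^sub>g G) \<longleftrightarrow> (G \<simeq>\<^sub>g C5 \<or> G \<simeq>\<^sub>g net_graph))"
proof -
  have "\<exists>k\<ge>1. jump_iter k G \<simeq>\<^sub>g G" if "jump_graph G \<simeq>\<^sub>g G"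
    using jump_iter_1_eq_if_jump_graph_eq[OF assms(1) that] by blast
  moreover have "G \<simeq>\<^sub>g C5 \<or> G \<simeq>\<^sub>g net_graph" if "\<exists>k\<ge>1. jump_iter k G \<simeq>\<^sub>g G"
    using that C5_or_net_if_jump_iter_eq[OF assms] by blast
  moreover have "jump_graph G \<simeq>\<^sub>g G" if "G \<simeq>\<^sub>g C5 \<or> G \<simeq>\<^sub>g net_graph"
    using assms(1) that by (rule jump_graph_eq_if_C5_or_net)
  ultimately show ?thesis
    by blast
qed

end
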